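(* Let $S$ be a semigroup, let $\sigma$ be an involutive morphism of $S$, and let $\mu$ be a complex measure on $S$ that is a linear combination of Dirac measures $(\delta_{z_i})_{i\in I}$ such that $z_i$ is contained in the center of $S$ for all $i\in I$. Let $\delta>0$ be fixed. If $f: S\to\mathbb{C}$ is a function which satisfies $$\left|\int_{S}f(\sigma(y)xt)\,d\mu(t)-\int_{S}f(xyt)\,d\mu(t)-2f(x)f(y)\right|\leq \delta$$ for all $x,y\in S$, then either $f$ is bounded on $S$ and $$|f(x)|\leq\frac{\|\mu\|+\sqrt{\|\mu\|^{2}+2\delta}}{2}\quad\text{for all }x\in S,$$ or $f$ is a solution of the functional equation $$\int_{S}f(\sigma(y)xt)\,d\mu(t)-\int_{S}f(xyt)\,d\mu(t) = 2f(x)f(y),\quad x,y\in S.$$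
   Context: An involutive morphism $\sigma$ of a semigroup $S$ is a map $\sigma:S\to S$ with $\sigma(\sigma(x))=x$ for all $x\in S$ that is either an automorphism ($\sigma(xy)=\sigma(x)\sigma(y)$ for all $x,y$) or an anti-automorphism ($\sigma(xy)=\sigma(y)\sigma(x)$ for all $x,y$). The center of $S$ is the set of elements commuting with every element of $S$. If $\mu=\sum_{i\in I}c_i\delta_{z_i}$ (a finite linear combination, $c_i\in\mathbb{C}$, the $z_i$ distinct), then $\int_S h(t)\,d\mu(t)=\sum_{i\in I}c_i h(z_i)$ for every $h:S\to\mathbb{C}$, and $\|\mu\|=\sum_{i\in I}|c_i|$ is the total variation norm. *)

theory Defs
  imports "HOL-Analysis.Analysis"
begin

definition center :: "'a::semigroup_mult set" where
  "center = {z. \<forall>x. z * x = x * z}"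

definition involutive_morphism :: "('a::semigroup_mult \<Rightarrow> 'a) \<Rightarrow> bool" where
  "involutive_morphism \<sigma> \<longleftrightarrow>
     (\<forall>x. \<sigma> (\<sigma> x) = x) \<and>
     ((\<forall>x y. \<sigma> (x * y) = \<sigma> x * \<sigma> y) \<or> (\<forall>x y. \<sigma> (x * y) = \<sigma> y * \<sigma> x))"

(* The measure mu = (\<Sum>i\<in>I. c i \<delta>_(z i)) is represented by its data: a finite index
   set I, complex weights c (possibly 0) and points z, pairwise distinct on I.  Finiteness
   of I and injectivity of z on I are to be assumed wherever this is used. *)
definition discrete_integral ::
    "'i set \<Rightarrow> ('i \<Rightarrow> complex) \<Rightarrow> ('i \<Rightarrow> 'a) \<Rightarrow> ('a \<Rightarrow> complex) \<Rightarrow> complex" where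
  "discrete_integral I c z h = (\<Sum>i\<in>I. c i * h (z i))"

(* This is the total variation only because the points z i are distinct. *)
definition total_variation :: "'i set \<Rightarrow> ('i \<Rightarrow> complex) \<Rightarrow> real" where
  "total_variation I c = (\<Sum>i\<in>I. cmod (c i))"

end

theory Submission
  imports Defs
begin

text \<open>
  The bounded case is a quadratic inequality for the supremum norm. Let $f$ be unbounded, let $F$ be
  the average of $f$ over $\mu$, $G$ that of $F$, and $D(x,y)$ the defect of the equation. If
  $f(w) D(x,y)$ is bounded in $w$, then $D(x,y) = 0$; by associativity, $2 f(w) D(x,y)$ is, up to
  such a bounded term, a combination of values of $G$ at products of $x$, $y$ and $w$. For an
  automorphism this combination is $2 F(x) (f(wy) - f(yw))$ up to a bounded term, and letting
  $F(x)$ tend to infinity shows that $f$ is central. For an anti-automorphism, comparing the two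
  ways of averaging $f(x) f(y)$ gives $k f(\sigma(y) x) = f(x) F(y) - f(y) F(x)$ up to a bounded
  term, where $k = \int f d\mu$. There $f$ and $F$ are linearly independent modulo bounded
  functions, and comparing coefficients forces $F \circ \sigma = F$, $f \circ \sigma = -f$,
  $G = -k f$ and bounded commutators, which makes the combination bounded.
\<close>

section \<open>Closure rules for bounded complex functions\<close>

lemma bdd_add:
  fixes u v :: "'b \<Rightarrow> complex"
  assumes "bounded (range u)" "bounded (range v)"
  shows "bounded (range (\<lambda>x. u x + v x))"
  using bounded_plus_comp[OF assms] .

lemma bdd_diff:
  fixes u v :: "'b \<Rightarrow> complex"
  assumes "bounded (range u)" "bounded (range v)"
  shows "bounded (range (\<lambda>x. u x - v x))"
  using bounded_minus_comp[OF assms] .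

lemma bdd_mult:
  fixes u v :: "'b \<Rightarrow> complex"
  assumes "bounded (range u)" "bounded (range v)"
  shows "bounded (range (\<lambda>x. u x * v x))"
proof -
  obtain K L where "\<And>x. cmod (u x) \<le> K" "\<And>x. cmod (v x) \<le> L"
    using assms by (auto simp: bounded_iff)
  then have "cmod (u x * v x) \<le> K * L" for x
    unfolding norm_mult by (intro mult_mono) (auto intro: order_trans[OF norm_ge_zero])
  then show ?thesis by (auto simp: bounded_iff)
qed

lemma bdd_const: "bounded (range (\<lambda>x. a :: complex))"
  by (auto simp: bounded_iff)

lemma bdd_sum:
  fixes u :: "'i \<Rightarrow> 'b \<Rightarrow> complex"
  assumes "\<And>i. i \<in> I \<Longrightarrow> bounded (range (u i))"
  shows "bounded (range (\<lambda>x. \<Sum>i\<in>I. u i x))"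
  using assms
  by (induction I rule: infinite_finite_induct) (auto intro: bdd_add simp: bdd_const)

lemma bdd_comp:
  fixes u :: "'b \<Rightarrow> complex"
  assumes "bounded (range u)"
  shows "bounded (range (\<lambda>x. u (g x)))"
  using assms by (rule bounded_subset) auto

lemma bdd_cong:
  fixes u v :: "'b \<Rightarrow> complex"
  assumes "\<And>x. u x = v x" "bounded (range v)"
  shows "bounded (range u)"
  using assms by presburger

lemma bdd_of_square:
  fixes u :: "'b \<Rightarrow> complex"
  assumes "bounded (range (\<lambda>x. u x * u x))"
  shows "bounded (range u)"
proof -
  obtain K where K: "\<And>x. cmod (u x * u x) \<le> K"
    using assms by (auto simp: bounded_iff)
  have "cmod (u x) \<le> sqrt K" for x
    using K[of x] by (intro real_le_rsqrt) (simp add: norm_mult power2_eq_square)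
  then show ?thesis by (auto simp: bounded_iff)
qed

lemmas bdd_intros = bdd_add bdd_diff bdd_mult bdd_const bdd_sum

text \<open>Source of the exact identities: a defect or a coefficient is shown to vanish by bounding
  its product with an unbounded function.\<close>

lemma bdd_cmult_imp_zero:
  fixes u :: "'b \<Rightarrow> complex"
  assumes "bounded (range (\<lambda>x. u x * a))" and "\<not> bounded (range u)"
  shows "a = 0"
proof (rule ccontr)
  assume "a \<noteq> 0"
  then have "u = (\<lambda>x. u x * a * inverse a)" by (simp add: fun_eq_iff mult.assoc)
  then show False using assms(2) bdd_mult[OF assms(1) bdd_const[of "inverse a"]] by metis
qed

section \<open>The approximate equation for unbounded \<open>f\<close> and its averages over
  \<mu>\<close>

locale approx_solution =
  fixes \<sigma> :: "'a::semigroup_mult \<Rightarrow> 'a"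
    and I :: "'i set" and c :: "'i \<Rightarrow> complex" and z :: "'i \<Rightarrow> 'a"
    and f :: "'a \<Rightarrow> complex" and F G :: "'a \<Rightarrow> complex"
    and D :: "'a \<Rightarrow> 'a \<Rightarrow> complex"
  defines "F \<equiv> \<lambda>x. \<Sum>i\<in>I. c i * f (x * z i)"
    and "G \<equiv> \<lambda>x. \<Sum>i\<in>I. c i * F (x * z i)"
    and "D \<equiv> \<lambda>x y. F (\<sigma> y * x) - F (x * y) - 2 * f x * f y"
  assumes morphism: "involutive_morphism \<sigma>"
    and z_center: "i \<in> I \<Longrightarrow> z i \<in> center"
    and D_bounded: "bounded (range (\<lambda>(x, y). D x y))"
    and f_unbounded: "\<not> bounded (range f)"
begin

lemma F_eq: "F x = (\<Sum>i\<in>I. c i * f (x * z i))"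
  by (simp add: F_def)

lemma sigma_sigma [simp]: "\<sigma> (\<sigma> x) = x"
  using morphism by (simp add: involutive_morphism_def)

lemma z_commute: "i \<in> I \<Longrightarrow> z i * x = x * z i"
  using z_center[of i] by (simp add: center_def)

text \<open>For an automorphism, first rewrite \<open>x * z i\<close> as
  \<open>z i * x\<close>.\<close>

lemma sigma_mult_z: "i \<in> I \<Longrightarrow> \<sigma> (x * z i) = \<sigma> (z i) * \<sigma> x"
  using z_center[of i] morphism unfolding center_def involutive_morphism_def
  by (metis (mono_tags, lifting) mem_Collect_eq)

text \<open>With \<open>u\<close> and \<open>v\<close> arbitrary, one rule covers boundedness in
  either argument and after any substitution; \<open>N_bdd\<close> and \<open>E_bdd\<close> have the
  same shape.\<close>

lemma D_bdd: "bounded (range (\<lambda>p. D (u p) (v p)))"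
  using bdd_comp[OF D_bounded, of "\<lambda>p. (u p, v p)"] by simp

definition "N x y = (\<Sum>i\<in>I. c i * D (x * z i) y)"

lemma N_bdd: "bounded (range (\<lambda>p. N (u p) (v p)))"
  unfolding N_def by (intro bdd_intros D_bdd)

lemma N_eq: "N x y = G (\<sigma> y * x) - G (x * y) - 2 * F x * f y"
proof -
  have "N x y = (\<Sum>i\<in>I. c i * F (\<sigma> y * x * z i) - c i * F (x * y * z i) - 2 * (c i * f (x * z i)) * f y)"
    unfolding N_def D_def
    by (intro sum.cong refl) (simp add: z_commute algebra_simps)
  also have "\<dots> = G (\<sigma> y * x) - G (x * y) - 2 * F x * f y"
    unfolding G_def F_def by (simp add: sum_subtractf sum_distrib_left sum_distrib_right)
  finally show ?thesis .
qed

definition "k = (\<Sum>i\<in>I. c i * f (z i))"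

definition "E x y = f x * F y - f y * F x - k * f (\<sigma> y * x)"

text \<open>Averaging \<open>D\<close> in its second argument produces values of \<open>F\<close> at
  \<open>\<sigma> (z i) * \<sigma> y * x\<close>. They recur in
  \<open>D (\<sigma> y * x) (z i)\<close> and cancel; adding \<open>N x y\<close> removes the values
  of \<open>G\<close>.\<close>

lemma E_eq:
  "E x y = (N x y + (\<Sum>i\<in>I. c i * D (\<sigma> y * x) (z i)) - (\<Sum>i\<in>I. c i * D x (y * z i))) / 2"
proof -
  have 1: "(\<Sum>i\<in>I. c i * D x (y * z i))
      = (\<Sum>i\<in>I. c i * F (\<sigma> (z i) * \<sigma> y * x)) - G (x * y) - 2 * f x * F y"
  proof -
    have "(\<Sum>i\<in>I. c i * D x (y * z i))
      = (\<Sum>i\<in>I. c i * F (\<sigma> (z i) * \<sigma> y * x) - c i * F (x * y * z i) - 2 * f x * (c i * f (y * z i)))"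
      unfolding D_def by (intro sum.cong refl) (simp add: sigma_mult_z algebra_simps)
    then show ?thesis
      unfolding G_def F_eq[of y] by (simp add: sum_subtractf sum_distrib_left)
  qed
  have 2: "(\<Sum>i\<in>I. c i * D (\<sigma> y * x) (z i))
      = (\<Sum>i\<in>I. c i * F (\<sigma> (z i) * \<sigma> y * x)) - G (\<sigma> y * x) - 2 * f (\<sigma> y * x) * k"
  proof -
    have "(\<Sum>i\<in>I. c i * D (\<sigma> y * x) (z i))
      = (\<Sum>i\<in>I. c i * F (\<sigma> (z i) * \<sigma> y * x) - c i * F (\<sigma> y * x * z i) - 2 * f (\<sigma> y * x) * (c i * f (z i)))"
      unfolding D_def by (intro sum.cong refl) (simp add: algebra_simps)
    then show ?thesis
      unfolding G_def k_def by (simp add: sum_subtractf sum_distrib_left)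
  qed
  show ?thesis unfolding 1 2 N_eq E_def by (simp add: field_simps)
qed

lemma E_bdd: "bounded (range (\<lambda>p. E (u p) (v p)))"
  unfolding E_eq divide_inverse by (intro bdd_intros D_bdd N_bdd)

definition "h x = f x + f (\<sigma> x)"

text \<open>Over the four pairs formed from \<open>x\<close> and \<open>\<sigma> x\<close>, the
  values of \<open>F\<close> in the defects cancel cyclically, leaving a multiple of the square of
  \<open>h x\<close>.\<close>

lemma h_bdd: "bounded (range (\<lambda>p. h (u p)))"
proof -
  have "h x * h x = (- 1 / 2) * (D x (\<sigma> x) + D x x + D (\<sigma> x) x + D (\<sigma> x) (\<sigma> x))" for x
    unfolding h_def D_def by (simp add: algebra_simps)
  then have "bounded (range (\<lambda>x. h x * h x))"
    by (rule bdd_cong) (intro bdd_intros D_bdd)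
  then show ?thesis by (rule bdd_comp[OF bdd_of_square])
qed

lemma F_unbounded: "\<not> bounded (range F)"
proof
  assume F: "bounded (range F)"
  have "f x * f x = (1 / 2) * (F (\<sigma> x * x) - F (x * x) - D x x)" for x
    unfolding D_def by simp
  then have "bounded (range (\<lambda>x. f x * f x))"
    by (rule bdd_cong) (intro bdd_intros D_bdd bdd_comp[OF F])
  then show False using bdd_of_square f_unbounded by blast
qed

text \<open>Expand $4 f(x) f(y) f(w)$ in two ways, starting from $f(x) f(y)$ or from $f(x) f(w)$.\<close>

lemma f_times_D:
  "2 * f w * D x y = G (\<sigma> w * \<sigma> y * x) - G (\<sigma> y * \<sigma> w * x) + G (x * y * w) - G (x * w * y)
     + (2 * f y * D x w - N (\<sigma> y * x) w + N (x * y) w + N (\<sigma> w * x) y - N (x * w) y)"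
  unfolding N_eq D_def by (simp add: algebra_simps)

section \<open>Automorphisms\<close>

lemma D_zero_automorphism:
  assumes hom: "\<And>x y. \<sigma> (x * y) = \<sigma> x * \<sigma> y"
  shows "D x y = 0"
proof -
  \<comment> \<open>Since \<open>\<sigma> w * \<sigma> y\<close> is \<open>\<sigma> (w * y)\<close>,
    the four values of \<open>G\<close> pair off into \<open>N x (w * y)\<close> and
    \<open>N x (y * w)\<close>.\<close>
  have id: "F x * (2 * (f (y * w) - f (w * y))) = 2 * f y * D x w - 2 * f w * D x y
      + (N x (w * y) - N x (y * w) - N (\<sigma> y * x) w + N (x * y) w + N (\<sigma> w * x) y - N (x * w) y)"
    for x y w
    unfolding f_times_D[of w x y] N_eq[of x "w * y"] N_eq[of x "y * w"] hom
    by (simp add: algebra_simps)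
  have comm: "f (y * w) = f (w * y)" for y w
  proof -
    have "bounded (range (\<lambda>x. F x * (2 * (f (y * w) - f (w * y)))))"
      unfolding id by (intro bdd_intros D_bdd N_bdd)
    from bdd_cmult_imp_zero[OF this F_unbounded] show ?thesis by simp
  qed
  have "f w * D x y = (1 / 2) * (2 * f y * D x w
      + (N x (w * y) - N x (y * w) - N (\<sigma> y * x) w + N (x * y) w + N (\<sigma> w * x) y - N (x * w) y))" for w
    using id[of x y w] comm[of y w] by (simp add: field_simps)
  then have "bounded (range (\<lambda>w. f w * D x y))"
    by (rule bdd_cong) (intro bdd_intros D_bdd N_bdd)
  then show ?thesis by (rule bdd_cmult_imp_zero[OF _ f_unbounded])
qed

section \<open>Anti-automorphisms\<close>

context
  assumes anti: "\<sigma> (x * y) = \<sigma> y * \<sigma> x"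
begin

text \<open>The two defects contain \<open>F (\<sigma> x * y)\<close> with opposite signs.\<close>

lemma F_sigma_mult: "F (\<sigma> (x * y)) = F (y * x) + 2 * f y * h x + (D (\<sigma> x) y + D y x)"
  unfolding D_def h_def anti by (simp add: algebra_simps)

text \<open>Otherwise $F + F \circ \sigma$ would be bounded, so $F(xy)$ would be close to $-F(yx)$.
  Replacing $y$ by $\sigma(y)$ in the approximate equation would then change the sign of its
  right-hand side but not of its left-hand side.\<close>

lemma F_not_multiple: "\<not> bounded (range (\<lambda>x. F x - l * f x))"
proof
  define r where "r x = F x - l * f x" for x
  assume "bounded (range (\<lambda>x. F x - l * f x))"
  then have r: "bounded (range (\<lambda>p. r (u p)))" for u :: "'b \<Rightarrow> 'a"
    unfolding r_def[symmetric] by (rule bdd_comp)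
  define s where "s x y = F (x * y) + F (y * x) + 2 * f y * h x" for x y
  have "s x y = r (x * y) + r (\<sigma> (x * y)) + l * h (x * y) - (D (\<sigma> x) y + D y x)" for x y
    using F_sigma_mult[of x y] unfolding s_def r_def h_def by (simp add: algebra_simps)
  then have s: "bounded (range (\<lambda>p. s (u p) (v p)))" for u v :: "'b \<Rightarrow> 'a"
    by (rule bdd_cong) (intro bdd_intros D_bdd r h_bdd)
  have h0: "h x = 0" for x
  proof -
    \<comment> \<open>The \<open>F\<close> part of \<open>s\<close> is symmetric, so only the terms
      with \<open>h\<close> survive in the difference.\<close>
    have "f y * h x = (1 / 2) * (s x y - s y x) + f x * h y" for y
      unfolding s_def by (simp add: algebra_simps)
    then have "bounded (range (\<lambda>y. f y * h x))"
      by (rule bdd_cong) (intro bdd_intros s h_bdd)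
    then show ?thesis by (rule bdd_cmult_imp_zero[OF _ f_unbounded])
  qed
  then have odd: "f (\<sigma> x) = - f x" for x
    unfolding h_def by (simp add: add_eq_0_iff)
  have "f x * f x = (1 / 4) * (D x (\<sigma> x) + s x (\<sigma> x) - D x x - s x x)" for x
    unfolding s_def D_def h0 sigma_sigma odd by (simp add: algebra_simps)
  then have "bounded (range (\<lambda>x. f x * f x))"
    by (rule bdd_cong) (intro bdd_intros s D_bdd)
  then show False using bdd_of_square f_unbounded by blast
qed

text \<open>Permits comparing coefficients of \<open>F\<close> and \<open>f\<close> in relations
  that hold up to bounded terms.\<close>

lemma f_F_independent:
  assumes "bounded (range (\<lambda>x. a * F x + b * f x))"
  shows "a = 0" "b = 0"
proof -
  show "a = 0"
  proof (rule ccontr)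
    assume "a \<noteq> 0"
    then have "F x - (- b / a) * f x = (1 / a) * (a * F x + b * f x)" for x
      by (simp add: field_simps)
    then have "bounded (range (\<lambda>x. F x - (- b / a) * f x))"
      by (rule bdd_cong) (intro bdd_intros assms)
    then show False using F_not_multiple by blast
  qed
  then have "bounded (range (\<lambda>x. f x * b))" using assms by (simp add: mult.commute)
  then show "b = 0" by (rule bdd_cmult_imp_zero[OF _ f_unbounded])
qed

lemma f_nonzero: obtains x where "f x \<noteq> 0"
proof -
  have "\<exists>x. f x \<noteq> 0"
  proof (rule ccontr)
    assume "\<nexists>x. f x \<noteq> 0"
    then have "f = (\<lambda>x. 0)" by auto
    then show False using f_unbounded bdd_const[of 0] by simp
  qed
  then show thesis using that by blast
qed

lemma k_nonzero: "k \<noteq> 0"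
proof
  assume k: "k = 0"
  obtain x where x: "f x \<noteq> 0" by (rule f_nonzero)
  have "f x * F y + (- F x) * f y = E x y" for y
    unfolding E_def k by simp
  then have "bounded (range (\<lambda>y. f x * F y + (- F x) * f y))"
    by (rule bdd_cong) (rule E_bdd)
  from f_F_independent(1)[OF this] x show False by simp
qed

text \<open>Averaging \<open>E\<close> in its first argument turns \<open>f\<close> into
  \<open>F\<close> and \<open>F\<close> into \<open>G\<close>.\<close>

lemma k_F: "k * F (\<sigma> y * x) = F x * F y - f y * G x - (\<Sum>i\<in>I. c i * E (x * z i) y)"
proof -
  have "(\<Sum>i\<in>I. c i * E (x * z i) y)
      = (\<Sum>i\<in>I. c i * f (x * z i) * F y - f y * (c i * F (x * z i)) - k * (c i * f (\<sigma> y * x * z i)))"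
    unfolding E_def by (intro sum.cong refl) (simp add: algebra_simps)
  then show ?thesis
    unfolding F_eq[of x] F_eq[of "\<sigma> y * x"] G_def
    by (simp add: sum_subtractf sum_distrib_left sum_distrib_right)
qed

text \<open>Expanding both values of \<open>F\<close> in \<open>k * D x y\<close> by
  \<open>k_F\<close> gives, for fixed \<open>x\<close>, a combination \<open>R x y\<close> of
  \<open>F y\<close>, \<open>G y\<close> and \<open>f y\<close> that is bounded in \<open>y\<close>.
  Eliminating \<open>G\<close> leaves coefficients to compare.\<close>

lemma F_sigma_and_G:
  shows "F (\<sigma> x) = F x" and "G x = - k * f (\<sigma> x) - 2 * k * f x"
proof -
  \<comment> \<open>Averaging \<open>E (z i) x\<close> over \<mu> shows that this \<open>q\<close>
    makes \<open>e\<close> bounded.\<close>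
  define q where "q = (\<Sum>i\<in>I. c i * F (z i)) / k"
  define e where "e x = F (\<sigma> x) - F x + q * f x" for x
  have qk: "q * k = (\<Sum>i\<in>I. c i * F (z i))"
    unfolding q_def using k_nonzero by simp
  have "e x = (- 1 / k) * (\<Sum>i\<in>I. c i * E (z i) x)" for x
  proof -
    have "(\<Sum>i\<in>I. c i * E (z i) x)
        = (\<Sum>i\<in>I. c i * f (z i) * F x - f x * (c i * F (z i)) - k * (c i * f (\<sigma> x * z i)))"
      unfolding E_def by (intro sum.cong refl) (simp add: algebra_simps)
    also have "\<dots> = k * F x - f x * (q * k) - k * F (\<sigma> x)"
      unfolding qk by (simp add: sum_subtractf sum_distrib_left sum_distrib_right k_def F_eq[of "\<sigma> x"])
    finally show ?thesis using k_nonzero unfolding e_def by (simp add: field_simps)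
  qed
  then have e_bdd: "bounded (range e)"
    by (rule bdd_cong) (intro bdd_intros E_bdd)

  define R where "R x y = (q * f x - e x) * F y + f (\<sigma> x) * G y - (G x + 2 * k * f x) * f y" for x y
  have "R x y = k * D x y + (\<Sum>i\<in>I. c i * E (x * z i) y) - (\<Sum>i\<in>I. c i * E (y * z i) (\<sigma> x))" for x y
    unfolding D_def right_diff_distrib k_F using k_F[of "\<sigma> x" y]
    unfolding R_def e_def sigma_sigma by (simp add: algebra_simps)
  then have R_bdd: "bounded (range (\<lambda>p. R x (u p)))" for x and u :: "'b \<Rightarrow> 'a"
    by (rule bdd_cong) (intro bdd_intros E_bdd D_bdd)

  obtain x1 where x1: "f x1 \<noteq> 0" by (rule f_nonzero)
  \<comment> \<open>In \<open>R (\<sigma> x1) y\<close> the coefficient of \<open>G y\<close> is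
    \<open>f x1\<close>, which is nonzero; solving for \<open>G y\<close> yields \<alpha>, \<beta>
    and the bounded remainder \<open>g\<close>.\<close>
  define \<alpha> where "\<alpha> = - (q * f (\<sigma> x1) - e (\<sigma> x1)) / f x1"
  define \<beta> where "\<beta> = (G (\<sigma> x1) + 2 * k * f (\<sigma> x1)) / f x1"
  define g where "g y = G y - \<alpha> * F y - \<beta> * f y" for y
  have "g y = (1 / f x1) * R (\<sigma> x1) y" for y
    using x1 unfolding g_def \<alpha>_def \<beta>_def R_def by (simp add: field_simps)
  then have g_bdd: "bounded (range g)"
    by (rule bdd_cong) (intro bdd_intros R_bdd)

  have "(q * f x - e x + \<alpha> * f (\<sigma> x)) * F y + (\<beta> * f (\<sigma> x) - G x - 2 * k * f x) * f y
      = R x y - f (\<sigma> x) * g y" for x y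
    unfolding R_def g_def by (simp add: algebra_simps)
  then have "bounded (range (\<lambda>y. (q * f x - e x + \<alpha> * f (\<sigma> x)) * F y
      + (\<beta> * f (\<sigma> x) - G x - 2 * k * f x) * f y))" for x
    by (rule bdd_cong) (intro bdd_intros R_bdd g_bdd)
  from f_F_independent[OF this]
  have 1: "e x = q * f x + \<alpha> * f (\<sigma> x)" and 2: "G x = \<beta> * f (\<sigma> x) - 2 * k * f x" for x
    by (simp_all add: algebra_simps)
  have "f x * (q - \<alpha>) = e x - \<alpha> * h x" for x
    unfolding 1 h_def by (simp add: algebra_simps)
  then have "bounded (range (\<lambda>x. f x * (q - \<alpha>)))"
    by (rule bdd_cong) (intro bdd_intros e_bdd h_bdd)
  from bdd_cmult_imp_zero[OF this f_unbounded] have q: "q = \<alpha>" by simp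
  \<comment> \<open>This equates the exact formula 2 for \<open>G\<close> with the approximate one
    that defines \<open>g\<close>.\<close>
  have "\<alpha> * F x + (2 * \<beta> + 2 * k) * f x = \<beta> * h x - g x" for x
    unfolding g_def 2 h_def by (simp add: algebra_simps)
  then have "bounded (range (\<lambda>x. \<alpha> * F x + (2 * \<beta> + 2 * k) * f x))"
    by (rule bdd_cong) (intro bdd_intros g_bdd h_bdd)
  from f_F_independent[OF this] have \<alpha>: "\<alpha> = 0" and "2 * (\<beta> + k) = 0"
    by (simp_all add: algebra_simps)
  then have \<beta>: "\<beta> = - k" by (simp add: add_eq_0_iff)
  show "F (\<sigma> x) = F x" using 1[of x] unfolding e_def q \<alpha> by simp
  show "G x = - k * f (\<sigma> x) - 2 * k * f x" using 2[of x] unfolding \<beta> .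
qed

lemma F_commutator:
  "F (x * y) - F (y * x) = 2 * f y * h x + (D (\<sigma> x) y + D y x)"
  using F_sigma_mult[of x y] by (simp add: F_sigma_and_G(1))

text \<open>The commutator of \<open>F\<close> is antisymmetric, so adding
  \<open>F_commutator\<close> for both orders bounds \<open>f y * h x + f x * h y\<close>.\<close>

lemma h_zero: "h x = 0"
proof -
  have "f y * h x = (- 1 / 2) * (D (\<sigma> x) y + D y x + (D (\<sigma> y) x + D x y)) - f x * h y" for y
    using F_commutator[of x y] F_commutator[of y x] by (simp add: field_simps)
  then have "bounded (range (\<lambda>y. f y * h x))"
    by (rule bdd_cong) (intro bdd_intros D_bdd h_bdd)
  then show ?thesis by (rule bdd_cmult_imp_zero[OF _ f_unbounded])
qed

lemma f_sigma: "f (\<sigma> x) = - f x"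
  using h_zero[of x] by (simp add: h_def add_eq_0_iff)

lemma F_commutator_bdd: "bounded (range (\<lambda>p. F (u p * v p) - F (v p * u p)))"
  unfolding F_commutator h_zero mult_zero_right add_0 by (intro bdd_intros D_bdd)

text \<open>A sine addition law up to a bounded term.\<close>

lemma k_f_mult: "k * f (x * y) = f x * F y + f y * F x - E y (\<sigma> x)"
  unfolding E_def by (simp add: f_sigma F_sigma_and_G(1))

lemma f_commutator_bdd: "bounded (range (\<lambda>p. f (u p * v p) - f (v p * u p)))"
proof -
  have "f (x * y) - f (y * x) = (1 / k) * (E x (\<sigma> y) - E y (\<sigma> x))" for x y
    using k_nonzero k_f_mult[of x y] k_f_mult[of y x] by (simp add: field_simps)
  then show ?thesis by (rule bdd_cong) (intro bdd_intros E_bdd)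
qed

text \<open>As \<open>G\<close> is \<open>- k * f\<close>, the \<open>G\<close> terms of
  \<open>f_times_D\<close> expand through \<open>E\<close> and \<open>k_f_mult\<close>. The terms
  with \<open>F x\<close> cancel, and \<open>f x\<close> meets only commutators of \<open>F\<close>,
  which are bounded in \<open>w\<close>.\<close>

lemma D_zero_antiautomorphism: "D x y = 0"
proof -
  have G: "G x = - k * f x" for x
    using F_sigma_and_G(2)[of x] by (simp add: f_sigma)
  have "f w * D x y = (1 / 2) * (E x (y * w) - E x (w * y)
      - 2 * f x * (F (y * w) - F (w * y))
      + (E (y * w) (\<sigma> x) - E (w * y) (\<sigma> x))
     + (2 * f y * D x w - N (\<sigma> y * x) w + N (x * y) w + N (\<sigma> w * x) y - N (x * w) y))" for w
  proof -
    have "G (\<sigma> w * \<sigma> y * x) - G (\<sigma> y * \<sigma> w * x)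
        = E x (y * w) - E x (w * y) - f x * (F (y * w) - F (w * y)) + F x * (f (y * w) - f (w * y))"
      unfolding G E_def anti by (simp add: algebra_simps)
    moreover have "G (x * y * w) - G (x * w * y)
        = E (y * w) (\<sigma> x) - E (w * y) (\<sigma> x)
          - f x * (F (y * w) - F (w * y)) - F x * (f (y * w) - f (w * y))"
      using k_f_mult[of x "y * w"] k_f_mult[of x "w * y"]
      unfolding G by (simp add: algebra_simps)
    ultimately have "(G (\<sigma> w * \<sigma> y * x) - G (\<sigma> y * \<sigma> w * x)) + (G (x * y * w) - G (x * w * y))
        = E x (y * w) - E x (w * y) - 2 * f x * (F (y * w) - F (w * y))
          + (E (y * w) (\<sigma> x) - E (w * y) (\<sigma> x))"
      by (simp only:) (simp add: algebra_simps)
    then have "2 * f w * D x y = E x (y * w) - E x (w * y) - 2 * f x * (F (y * w) - F (w * y))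
        + (E (y * w) (\<sigma> x) - E (w * y) (\<sigma> x))
        + (2 * f y * D x w - N (\<sigma> y * x) w + N (x * y) w + N (\<sigma> w * x) y - N (x * w) y)"
      unfolding f_times_D[of w x y] by (simp only: add_diff_eq)
    then show ?thesis by (simp add: mult.commute mult.left_commute)
  qed
  then have "bounded (range (\<lambda>w. f w * D x y))"
    by (rule bdd_cong) (intro bdd_intros D_bdd N_bdd E_bdd F_commutator_bdd)
  then show ?thesis by (rule bdd_cmult_imp_zero[OF _ f_unbounded])
qed

end

lemma D_zero: "D x y = 0"
  using morphism D_zero_automorphism D_zero_antiautomorphism
  unfolding involutive_morphism_def by blast

end

section \<open>The bound for bounded \<open>f\<close>\<close>

lemma bounded_solution_bound:
  fixes f :: "'a::semigroup_mult \<Rightarrow> complex"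
  assumes bdd: "bounded (range f)"
    and approx: "\<And>x y. cmod (discrete_integral I c z (\<lambda>t. f (\<sigma> y * x * t))
                    - discrete_integral I c z (\<lambda>t. f (x * y * t)) - 2 * f x * f y) \<le> \<delta>"
  shows "cmod (f x) \<le> (total_variation I c + sqrt ((total_variation I c)\<^sup>2 + 2 * \<delta>)) / 2"
proof -
  define V where "V = total_variation I c"
  define B where "B = (SUP x. cmod (f x))"
  have bdd': "bdd_above (range (\<lambda>x. cmod (f x)))"
    using bdd by (auto simp: bounded_iff intro: bdd_aboveI)
  have B: "cmod (f x) \<le> B" for x
    unfolding B_def by (rule cSUP_upper[OF _ bdd']) simp
  then have B0: "0 \<le> B" using norm_ge_zero order_trans by blast
  have V0: "0 \<le> V" unfolding V_def total_variation_def by (simp add: sum_nonneg)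
  have int: "cmod (discrete_integral I c z (\<lambda>t. f (w * t))) \<le> V * B" for w
    unfolding V_def total_variation_def discrete_integral_def sum_distrib_right
    by (rule sum_norm_le) (simp add: norm_mult mult_left_mono B)
  \<comment> \<open>Take \<open>y = x\<close> and bound each integral by
    \<open>V * B\<close>.\<close>
  have sq: "(cmod (f x))\<^sup>2 \<le> V * B + \<delta> / 2" for x
  proof -
    let ?a = "discrete_integral I c z (\<lambda>t. f (\<sigma> x * x * t))"
    let ?b = "discrete_integral I c z (\<lambda>t. f (x * x * t))"
    have "cmod (2 * f x * f x) = cmod ((?a - ?b) - (?a - ?b - 2 * f x * f x))" by simp
    also have "\<dots> \<le> cmod (?a - ?b) + cmod (?a - ?b - 2 * f x * f x)" by (rule norm_triangle_ineq4)
    also have "\<dots> \<le> (cmod ?a + cmod ?b) + \<delta>"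
      using approx[of x x] by (intro add_mono norm_triangle_ineq4)
    also have "\<dots> \<le> (V * B + V * B) + \<delta>" using int by (intro add_mono) auto
    finally show ?thesis by (simp add: norm_mult power2_eq_square field_simps)
  qed
  then have "cmod (f x) \<le> sqrt (V * B + \<delta> / 2)" for x by (rule real_le_rsqrt)
  then have "B \<le> sqrt (V * B + \<delta> / 2)" unfolding B_def by (intro cSUP_least) auto
  \<comment> \<open>\<open>sq\<close> also makes the radicand nonnegative, so squaring removes the
    root.\<close>
  then have "B\<^sup>2 \<le> V * B + \<delta> / 2"
    using power_mono[OF _ B0, of _ 2] order_trans[OF zero_le_power2 sq] by fastforce
  \<comment> \<open>Multiply by 4 and complete the square.\<close>
  then have "(2 * B - V)\<^sup>2 \<le> V\<^sup>2 + 2 * \<delta>"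
    by (simp add: power2_eq_square algebra_simps)
  then have "2 * B - V \<le> sqrt (V\<^sup>2 + 2 * \<delta>)" by (rule real_le_rsqrt)
  then show ?thesis using B[of x] unfolding V_def[symmetric] by simp
qed

theorem theorem4p2:
  fixes \<sigma> :: "'a::semigroup_mult \<Rightarrow> 'a"
    and I :: "'i set" and c :: "'i \<Rightarrow> complex" and z :: "'i \<Rightarrow> 'a"
    and \<delta> :: real and f :: "'a \<Rightarrow> complex"
  assumes "involutive_morphism \<sigma>"
    and "finite I" and "inj_on z I"
    and "\<forall>i\<in>I. z i \<in> center"
    and "\<delta> > 0"
    and "\<forall>x y. cmod (discrete_integral I c z (\<lambda>t. f (\<sigma> y * x * t))
                    - discrete_integral I c z (\<lambda>t. f (x * y * t)) - 2 * f x * f y) \<le> \<delta>"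
  shows "(bounded (range f) \<and>
          (\<forall>x. cmod (f x) \<le> (total_variation I c + sqrt ((total_variation I c)\<^sup>2 + 2 * \<delta>)) / 2))
       \<or> (\<forall>x y. discrete_integral I c z (\<lambda>t. f (\<sigma> y * x * t))
                - discrete_integral I c z (\<lambda>t. f (x * y * t)) = 2 * f x * f y)"
proof (cases "bounded (range f)")
  case True
  then show ?thesis using bounded_solution_bound[of f I c z \<sigma> \<delta>] assms(6) by blast
next
  case False
  interpret approx_solution \<sigma> I c z f
    "\<lambda>x. \<Sum>i\<in>I. c i * f (x * z i)"
    "\<lambda>x. \<Sum>i\<in>I. c i * (\<Sum>j\<in>I. c j * f (x * z i * z j))"
    "\<lambda>x y. (\<Sum>i\<in>I. c i * f (\<sigma> y * x * z i)) - (\<Sum>i\<in>I. c i * f (x * y * z i)) - 2 * f x * f y"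
    using assms False
    by unfold_locales (auto simp: bounded_iff discrete_integral_def)
  show ?thesis using D_zero unfolding discrete_integral_def by simp
qed

end
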